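(* Let $A$ be a locally finite positively graded elementary algebra over a field $\Bbbk$ satisfying the standing hypotheses, with signed Euler--Smith profile $(a_1\le\cdots\le a_r)$ at $1$. If $a_r<0$, then for every $i\in\{1,\ldots,r\}$ the corner Hilbert series $\sum_{n\ge0}\dim_\Bbbk(e_iA_ne_i)x^n$ has radius of convergence strictly less than $1$.
   Context: All algebras are associative and unital; $\Bbbk$ is an arbitrary field. A locally finite positively graded elementary algebra is a graded algebra $A=\bigoplus_{n\ge0}A_n$ with $\dim_\Bbbk A_n<\infty$ for all $n$ and $A_0=\bigoplus_{i=1}^r\Bbbk e_i$ for primitive orthogonal idempotents $e_1,\ldots,e_r$. Put $J=A_{>0}$. The vertex simples are the graded left modules $S_j=Ae_j/Je_j$. A graded module is of graded type $\mathrm{FP}_\infty$ if it has a projective resolution by finitely generated graded projectives in every homological degree. The matrix Hilbert series $C_A(x)\in M_r(\mathbb Z[[x]])$ has entries $C_A(x)_{ij}=\sum_{n\ge0}\dim_\Bbbk(e_iA_ne_j)x^n$. Standing hypotheses on $A$: every $S_j$ is of graded type $\mathrm{FP}_\infty$, and $C_A(x)\in M_r(\mathbb Q(x))$. Put $\mathcal E_A(x)=C_A(x)^{-1}\in GL_r(\mathbb Q(x))$. Put $t=x-1$. There are $U,V\in GL_r(\mathbb Q[[t]])$ and unique integers $a_1\le\cdots\le a_r$ with $U\,\mathcal E_A(1+t)\,V=\operatorname{diag}(t^{a_1},\ldots,t^{a_r})$; $(a_1,\ldots,a_r)$ is the signed Euler--Smith profile at $1$. *)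

theory Defs
  imports
    "HOL-Analysis.Summation_Tests"
    "HOL-Computational_Algebra.Computational_Algebra"
    "HOL-Computational_Algebra.Field_as_Ring"
    "HOL-Algebra.AbelCoset"
    "HOL-Algebra.Module"
    "Jordan_Normal_Form.Matrix"
begin

section \<open>Elementary graded algebras\<close>

text \<open>
  The algebra is a type \<^typ>\<open>'a::ring_1\<close> (not necessarily commutative) with a scalar
  multiplication by a field.
\<close>

locale graded_algebra = vector_space scale
  for scale :: "'k::field \<Rightarrow> 'a::ring_1 \<Rightarrow> 'a" +
  fixes A :: "nat \<Rightarrow> 'a set"
  assumes scale_mult_left: "scale c x * y = scale c (x * y)"
    and scale_mult_right: "x * scale c y = scale c (x * y)"
    and subspace_component: "subspace (A n)"
    and direct_sum: "\<exists>!f. (\<forall>n. f n \<in> A n) \<and> finite {n. f n \<noteq> 0} \<and> x = (\<Sum>n | f n \<noteq> 0. f n)"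
    and one_component: "1 \<in> A 0"
    and mult_component: "x \<in> A m \<Longrightarrow> y \<in> A n \<Longrightarrow> x * y \<in> A (m + n)"
begin

definition positive_part :: "'a set" where
  "positive_part = span (\<Union>n\<in>{0<..}. A n)"

end

definition primitive_idempotent :: "'a::ring_1 \<Rightarrow> bool" where
  "primitive_idempotent e \<longleftrightarrow> e \<noteq> 0 \<and> e * e = e \<and>
     (\<forall>f g. f * f = f \<and> g * g = g \<and> f * g = 0 \<and> g * f = 0 \<and> e = f + g \<longrightarrow> f = 0 \<or> g = 0)"

text \<open>The vertices are numbered from \<open>0\<close> to \<open>r - 1\<close>, as are the rows and columns of matrices.\<close>

locale elementary_graded_algebra = graded_algebra scale A
  for scale :: "'k::field \<Rightarrow> 'a::ring_1 \<Rightarrow> 'a" and A :: "nat \<Rightarrow> 'a set" +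
  fixes e :: "nat \<Rightarrow> 'a" and r :: nat
  assumes locally_finite: "\<exists>B. finite B \<and> span B = A n"
    and primitive: "i < r \<Longrightarrow> primitive_idempotent (e i)"
    and orthogonal: "i < r \<Longrightarrow> j < r \<Longrightarrow> i \<noteq> j \<Longrightarrow> e i * e j = 0"
    and inj_idempotents: "inj_on e {..<r}"
    and independent_idempotents: "independent (e ` {..<r})"
    and span_idempotents: "span (e ` {..<r}) = A 0"
begin

definition corner_component :: "nat \<Rightarrow> nat \<Rightarrow> nat \<Rightarrow> 'a set" where
  "corner_component i j n = {e i * x * e j | x. x \<in> A n}"

definition hilbert_series :: "nat \<Rightarrow> nat \<Rightarrow> int fps" where
  "hilbert_series i j = Abs_fps (\<lambda>n. int (dim (corner_component i j n)))"

definition matrix_hilbert_series :: "int fps mat" where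
  "matrix_hilbert_series = Matrix.mat r r (\<lambda>(i, j). hilbert_series i j)"

end


section \<open>Graded left modules\<close>

text \<open>
  The fields \<open>mult\<close> and \<open>one\<close> of the underlying record are irrelevant, as usual for modules in
  \<open>HOL-Algebra\<close>. The locale \<^locale>\<open>Module.module\<close> itself assumes a commutative ring of scalars,
  hence the following variant. Modules are \<open>\<int>\<close>-graded.
\<close>

record ('a, 'm) graded_module = "('a, 'm) module" +
  component :: "int \<Rightarrow> 'm set"

locale graded_left_module = abelian_group M
  for A :: "nat \<Rightarrow> 'a::ring_1 set" and M :: "('a, 'm, 's) graded_module_scheme" (structure) +
  assumes smult_closed: "x \<in> carrier M \<Longrightarrow> a \<odot> x \<in> carrier M"
    and smult_add_left: "x \<in> carrier M \<Longrightarrow> (a + b) \<odot> x = a \<odot> x \<oplus> b \<odot> x"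
    and smult_add_right: "x \<in> carrier M \<Longrightarrow> y \<in> carrier M \<Longrightarrow> a \<odot> (x \<oplus> y) = a \<odot> x \<oplus> a \<odot> y"
    and smult_mult: "x \<in> carrier M \<Longrightarrow> (a * b) \<odot> x = a \<odot> (b \<odot> x)"
    and smult_one: "x \<in> carrier M \<Longrightarrow> 1 \<odot> x = x"
    and component_subgroup: "additive_subgroup (component M n) M"
    and component_direct_sum:
      "x \<in> carrier M \<Longrightarrow> \<exists>!f. (\<forall>n. f n \<in> component M n) \<and> finite {n. f n \<noteq> \<zero>} \<and>
         x = finsum M f {n. f n \<noteq> \<zero>}"
    and smult_component: "a \<in> A m \<Longrightarrow> x \<in> component M n \<Longrightarrow> a \<odot> x \<in> component M (int m + n)"

definition graded_hom ::
  "('a, 'm, 's) graded_module_scheme \<Rightarrow> ('a, 'n, 't) graded_module_scheme \<Rightarrow> ('m \<Rightarrow> 'n) set" where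
  "graded_hom M N = {f \<in> hom (add_monoid M) (add_monoid N).
     (\<forall>a. \<forall>x\<in>carrier M. f (a \<odot>\<^bsub>M\<^esub> x) = a \<odot>\<^bsub>N\<^esub> f x) \<and>
     (\<forall>n. f ` component M n \<subseteq> component N n)}"

definition finitely_generated :: "('a, 'm, 's) graded_module_scheme \<Rightarrow> bool" where
  "finitely_generated M \<longleftrightarrow> (\<exists>X. finite X \<and> X \<subseteq> carrier M \<and>
     (\<forall>x\<in>carrier M. \<exists>c. x = finsum M (\<lambda>y. c y \<odot>\<^bsub>M\<^esub> y) X))"

text \<open>
  The test modules are carried by subsets of the same type as \<^term>\<open>P\<close>. Below, that type is
  \<^typ>\<open>nat \<Rightarrow> 'a\<close>. It accommodates all free modules of finite rank over the algebra, with every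
  grading, and therefore a graded free cover of each finitely generated module \<^term>\<open>P\<close> and, up to
  isomorphism, all finitely generated graded projective modules. Lifting the identity of \<^term>\<open>P\<close>
  through such a cover shows that \<^term>\<open>P\<close> is a direct summand of it, so that \<^term>\<open>P\<close> has the
  lifting property with respect to arbitrary graded modules as well.
\<close>

definition graded_projective :: "(nat \<Rightarrow> 'a::ring_1 set) \<Rightarrow> ('a, 'm) graded_module \<Rightarrow> bool" where
  "graded_projective A P \<longleftrightarrow> graded_left_module A P \<and>
     (\<forall>(M :: ('a, 'm) graded_module) (N :: ('a, 'm) graded_module) g f.
        graded_left_module A M \<and> graded_left_module A N \<and>
        g \<in> graded_hom M N \<and> g ` carrier M = carrier N \<and> f \<in> graded_hom P N \<longrightarrow>
        (\<exists>h\<in>graded_hom P M. \<forall>x\<in>carrier P. g (h x) = f x))"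

text \<open>
  \<open>\<dots> \<rightarrow> P 1 \<rightarrow> P 0 \<rightarrow> M \<rightarrow> 0\<close> with differentials \<open>d n : P (n + 1) \<rightarrow> P n\<close> and augmentation \<open>\<epsilon>\<close>.
\<close>

definition graded_FP_infinity ::
  "(nat \<Rightarrow> 'a::ring_1 set) \<Rightarrow> ('a, 'm) graded_module \<Rightarrow> bool" where
  "graded_FP_infinity A M \<longleftrightarrow> graded_left_module A M \<and>
     (\<exists>(P :: nat \<Rightarrow> ('a, nat \<Rightarrow> 'a) graded_module) d \<epsilon>.
        (\<forall>n. graded_projective A (P n) \<and> finitely_generated (P n)) \<and>
        (\<forall>n. d n \<in> graded_hom (P (Suc n)) (P n)) \<and>
        \<epsilon> \<in> graded_hom (P 0) M \<and>
        \<epsilon> ` carrier (P 0) = carrier M \<and>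
        d 0 ` carrier (P 1) = a_kernel (P 0) M \<epsilon> \<and>
        (\<forall>n. d (Suc n) ` carrier (P (Suc (Suc n))) = a_kernel (P (Suc n)) (P n) (d n)))"

definition graded_quotient ::
  "('a, 'm) graded_module \<Rightarrow> 'm set \<Rightarrow> ('a, 'm set) graded_module" where
  "graded_quotient M N =
     \<lparr>carrier = a_rcosets\<^bsub>M\<^esub> N, mult = undefined, one = undefined, zero = N, add = set_add M,
      smult = (\<lambda>a X. \<Union>x\<in>X. N +>\<^bsub>M\<^esub> (a \<odot>\<^bsub>M\<^esub> x)),
      component = (\<lambda>n. (\<lambda>x. N +>\<^bsub>M\<^esub> x) ` component M n)\<rparr>"

context elementary_graded_algebra
begin

definition vertex_projective :: "nat \<Rightarrow> ('a, 'a) graded_module" where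
  "vertex_projective j =
     \<lparr>carrier = {x * e j | x. True}, mult = undefined, one = undefined, zero = 0, add = (+),
      smult = (*),
      component = (\<lambda>n. if n < 0 then {0} else {x * e j | x. x \<in> A (nat n)})\<rparr>"

definition vertex_simple :: "nat \<Rightarrow> ('a, 'a set) graded_module" where
  "vertex_simple j = graded_quotient (vertex_projective j) {x * e j | x. x \<in> positive_part}"

end


section \<open>Laurent expansions and the signed Euler--Smith profile\<close>

text \<open>
  \<^typ>\<open>rat poly fract\<close> is \<open>\<rat>(x)\<close>, and \<open>laurent_expansion c\<close> is its embedding into \<open>\<rat>((t))\<close> by
  the substitution \<open>x = c + t\<close>.
\<close>

definition laurent_expansion :: "rat \<Rightarrow> rat poly fract \<Rightarrow> rat fls" where
  "laurent_expansion c R = (case quot_of_fract R of (p, q) \<Rightarrow>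
     fps_to_fls (fps_of_poly (p \<circ>\<^sub>p [:c, 1:])) / fps_to_fls (fps_of_poly (q \<circ>\<^sub>p [:c, 1:])))"

definition int_fps_to_fls :: "int fps \<Rightarrow> rat fls" where
  "int_fps_to_fls F = fps_to_fls (Abs_fps (\<lambda>n. rat_of_int (fps_nth F n)))"

text \<open>\<open>C\<close> is the matrix over \<open>\<rat>(x)\<close> represented by the matrix \<open>H\<close> of power series.\<close>

definition rational_form :: "nat \<Rightarrow> int fps mat \<Rightarrow> rat poly fract mat \<Rightarrow> bool" where
  "rational_form r H C \<longleftrightarrow> C \<in> carrier_mat r r \<and>
     map_mat (laurent_expansion 0) C = map_mat int_fps_to_fls H"

definition signed_euler_smith_profile ::
  "nat \<Rightarrow> rat poly fract mat \<Rightarrow> int list \<Rightarrow> bool" where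
  "signed_euler_smith_profile r E as \<longleftrightarrow> length as = r \<and> sorted as \<and>
     (\<exists>(U :: rat fps mat)\<in>carrier_mat r r. \<exists>(V :: rat fps mat)\<in>carrier_mat r r.
        invertible_mat U \<and> invertible_mat V \<and>
        map_mat fps_to_fls U * map_mat (laurent_expansion 1) E * map_mat fps_to_fls V =
          mat_diag r (\<lambda>i. fls_X_intpow (as ! i)))"

end

theory Submission
  imports Defs "HOL-Analysis.FPS_Convergence"
begin

text \<open>
  The Euler matrix \<open>E\<close> is the inverse of the Hilbert matrix \<open>C\<close>, so a Smith form
  \<open>U E(1+t) V = diag(t^a\<^sub>1, \<dots>, t^a\<^sub>r)\<close> over \<open>\<rat>[[t]]\<close> gives
  \<open>C(1+t) = V diag(t^-a\<^sub>1, \<dots>, t^-a\<^sub>r) U\<close>. If the largest exponent \<open>a\<^sub>r\<close> is negative, every entry of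
  the diagonal factor is divisible by \<open>t\<close>, and so every entry of \<open>C\<close> is a rational function that
  is regular at \<open>x = 1\<close> and vanishes there
  (\<open>inverse_entry_vanishes_at_one\<close>).

  For a corner Hilbert series \<open>h\<close> on the diagonal this is incompatible with convergence on the open
  unit disc. Its coefficients are dimensions and its constant term is \<open>dim (e\<^sub>i A\<^sub>0 e\<^sub>i) \<ge> 1\<close>
  (\<open>dim_corner_zero_pos\<close>), so \<open>h x \<ge> 1\<close> for \<open>0 < x < 1\<close>, whereas the rational function
  that \<open>h\<close> represents tends to \<open>0\<close> as \<open>x\<close> tends to \<open>1\<close>
  (\<open>conv_radius_less_one_if_vanishing_at_one\<close>).
\<close>

section \<open>Laurent expansion as a field homomorphism\<close>

lemma fps_of_poly_shift_eq_0_iff [simp]: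
  fixes q :: "'a::idom poly"
  shows "fps_of_poly (q \<circ>\<^sub>p [:c, 1:]) = 0 \<longleftrightarrow> q = 0"
proof -
  have "q \<circ>\<^sub>p [:c, 1:] = 0 \<longleftrightarrow> q = 0"
    by (rule pcompose_eq_0_iff) simp
  moreover have "fps_of_poly (q \<circ>\<^sub>p [:c, 1:]) = 0 \<longleftrightarrow> q \<circ>\<^sub>p [:c, 1:] = 0"
    by (metis fps_of_poly_0 fps_of_poly_eq_iff)
  ultimately show ?thesis by simp
qed

text \<open>
  The expansion is defined through the normalized numerator and denominator. That any representing
  fraction may be used instead is what makes compatibility with the field operations visible.
\<close>

lemma laurent_expansion_Fract:
  assumes "q \<noteq> 0"
  shows "laurent_expansion c (Fract p q) =
    fps_to_fls (fps_of_poly (p \<circ>\<^sub>p [:c, 1:])) / fps_to_fls (fps_of_poly (q \<circ>\<^sub>p [:c, 1:]))"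
proof -
  let ?\<phi> = "\<lambda>p. fps_to_fls (fps_of_poly (p \<circ>\<^sub>p [:c, 1:]))"
  obtain p' q' where pq: "quot_of_fract (Fract p q) = (p', q')"
    by (cases "quot_of_fract (Fract p q)")
  have q': "q' \<noteq> 0"
    using snd_quot_of_fract_nonzero[of "Fract p q"] by (simp add: pq)
  have "Fract p' q' = Fract p q"
    using Fract_quot_of_fract[of "Fract p q"] by (simp add: pq)
  then have "p' * q = p * q'"
    using assms q' by (simp add: eq_fract)
  then have "?\<phi> (p' * q) = ?\<phi> (p * q')"
    by simp
  then have "?\<phi> p' * ?\<phi> q = ?\<phi> p * ?\<phi> q'"
    by (simp add: pcompose_mult fps_of_poly_mult fls_times_fps_to_fls)
  then have "?\<phi> p' / ?\<phi> q' = ?\<phi> p / ?\<phi> q"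
    using assms q' by (simp add: frac_eq_eq)
  then show ?thesis
    by (simp add: laurent_expansion_def pq)
qed

lemma semiring_hom_laurent_expansion: "semiring_hom (laurent_expansion c)"
proof
  show "laurent_expansion c 0 = 0"
    using laurent_expansion_Fract[of 1 c 0] by (simp flip: Zero_fract_def)
  show "laurent_expansion c 1 = 1"
    using laurent_expansion_Fract[of 1 c 1] by (simp flip: One_fract_def)
next
  fix R S :: "rat poly fract"
  obtain p q where R: "R = Fract p q" "q \<noteq> 0" by (cases R) auto
  obtain p' q' where S: "S = Fract p' q'" "q' \<noteq> 0" by (cases S) auto
  let ?\<phi> = "\<lambda>p :: rat poly. fps_to_fls (fps_of_poly (p \<circ>\<^sub>p [:c, 1:]))"
  have \<phi>_mult: "?\<phi> (u * v) = ?\<phi> u * ?\<phi> v" for u v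
    by (simp add: pcompose_mult fps_of_poly_mult fls_times_fps_to_fls)
  have \<phi>_add: "?\<phi> (u + v) = ?\<phi> u + ?\<phi> v" for u v
    by (simp add: pcompose_add fps_of_poly_add)
  have nz: "?\<phi> q \<noteq> 0" "?\<phi> q' \<noteq> 0" "q * q' \<noteq> 0"
    using R S by simp_all
  have expand_R: "laurent_expansion c R = ?\<phi> p / ?\<phi> q"
    and expand_S: "laurent_expansion c S = ?\<phi> p' / ?\<phi> q'"
    by (simp_all only: R(1) S(1) laurent_expansion_Fract[OF R(2)] laurent_expansion_Fract[OF S(2)])
  have "laurent_expansion c (R * S) = ?\<phi> (p * p') / ?\<phi> (q * q')"
    by (simp only: R(1) S(1) mult_fract laurent_expansion_Fract[OF nz(3)])
  also have "\<dots> = laurent_expansion c R * laurent_expansion c S"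
    by (simp only: \<phi>_mult expand_R expand_S times_divide_times_eq)
  finally show "laurent_expansion c (R * S) = laurent_expansion c R * laurent_expansion c S" .
  have "laurent_expansion c (R + S) = ?\<phi> (p * q' + p' * q) / ?\<phi> (q * q')"
    by (simp only: R(1) S(1) add_fract[OF R(2) S(2)] laurent_expansion_Fract[OF nz(3)])
  also have "\<dots> = laurent_expansion c R + laurent_expansion c S"
    by (simp only: \<phi>_mult \<phi>_add expand_R expand_S add_frac_eq[OF nz(1,2)])
  finally show "laurent_expansion c (R + S) = laurent_expansion c R + laurent_expansion c S" .
qed

lemma semiring_hom_fps_to_fls: "semiring_hom (fps_to_fls :: 'a::semiring_1 fps \<Rightarrow> 'a fls)"
  by unfold_locales (simp_all add: fls_times_fps_to_fls)


section \<open>Vanishing of the Hilbert matrix at one\<close>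

lemma invertible_mat_obtain_inverse:
  assumes "invertible_mat U" "U \<in> carrier_mat r r"
  obtains U' where "U' \<in> carrier_mat r r" "U * U' = 1\<^sub>m r" "U' * U = 1\<^sub>m r"
proof -
  obtain U' where U': "U * U' = 1\<^sub>m r" "U' * U = 1\<^sub>m (dim_row U')"
    using assms by (auto simp: invertible_mat_def inverts_mat_def)
  have "dim_col U' = r" "dim_row U' = r"
    using U' assms(2) by (metis carrier_matD(2) index_mult_mat(3) index_one_mat(3))+
  then show thesis
    using U' by (intro that[of U']) auto
qed

text \<open>
  Multiplying \<open>C E = 1\<close> on the right by \<open>V diag(t^-a) U\<close> isolates the expansion of \<open>C\<close>, because
  that matrix inverts the expansion of \<open>E\<close>.
\<close>

lemma inverse_entry_vanishes_at_one:
  assumes C: "C \<in> carrier_mat r r" and E: "E \<in> carrier_mat r r" and CE: "C * E = 1\<^sub>m r"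
    and profile: "signed_euler_smith_profile r E as" and neg: "last as < 0"
    and ij: "i < r" "j < r"
  obtains G where "laurent_expansion 1 (C $$ (i, j)) = fps_to_fls G" "fps_nth G 0 = 0"
proof -
  interpret L: semiring_hom "laurent_expansion 1" by (rule semiring_hom_laurent_expansion)
  interpret F: semiring_hom "fps_to_fls :: rat fps \<Rightarrow> rat fls" by (rule semiring_hom_fps_to_fls)
  let ?L = "map_mat (laurent_expansion 1)" and ?F = "map_mat (fps_to_fls :: rat fps \<Rightarrow> rat fls)"
  let ?D = "mat_diag r (\<lambda>i. fls_X_intpow (as ! i)) :: rat fls mat"
  define D' :: "rat fps mat" where "D' = mat_diag r (\<lambda>i. fps_X ^ nat (- (as ! i)))"
  have as: "length as = r" "sorted as"
    using profile by (auto simp: signed_euler_smith_profile_def)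
  have as_neg: "as ! k < 0" if "k < r" for k
  proof -
    have "as ! k \<le> as ! (r - 1)"
      using that as by (intro sorted_nth_mono) auto
    also have "as ! (r - 1) = last as"
      using that as by (subst last_conv_nth) auto
    finally show ?thesis using neg by simp
  qed
  obtain U V :: "rat fps mat" where U: "U \<in> carrier_mat r r" "invertible_mat U"
    and V: "V \<in> carrier_mat r r" "invertible_mat V"
    and smith: "?F U * ?L E * ?F V = ?D"
    using profile unfolding signed_euler_smith_profile_def by blast
  obtain U' where U': "U' \<in> carrier_mat r r" "U * U' = 1\<^sub>m r" "U' * U = 1\<^sub>m r"
    using invertible_mat_obtain_inverse U by metis
  have D': "D' \<in> carrier_mat r r"
    by (simp add: D'_def)
  have FU: "?F U \<in> carrier_mat r r" and FU': "?F U' \<in> carrier_mat r r"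
    and FV: "?F V \<in> carrier_mat r r" and FD': "?F D' \<in> carrier_mat r r"
    and LC: "?L C \<in> carrier_mat r r" and LE: "?L E \<in> carrier_mat r r"
    using U V U' D' C E by auto
  have FU'U: "?F U' * ?F U = 1\<^sub>m r"
    using F.mat_hom_mult[OF U'(1) U(1)] U'(3) F.mat_hom_one[of r] by simp
  have "?F D' = mat_diag r (\<lambda>i. fls_X_intpow (- (as ! i)))"
  proof (rule eq_matI)
    fix k l assume "k < dim_row (mat_diag r (\<lambda>i. fls_X_intpow (- (as ! i)) :: rat fls))"
      and "l < dim_col (mat_diag r (\<lambda>i. fls_X_intpow (- (as ! i)) :: rat fls))"
    then have "k < r" "l < r" by (auto simp: mat_diag_def)
    then show "?F D' $$ (k, l) = mat_diag r (\<lambda>i. fls_X_intpow (- (as ! i))) $$ (k, l)"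
      using as_neg[of k]
      by (auto simp: D'_def mat_diag_def fps_to_fls_power fls_X_power_conv_shift_1)
  qed (auto simp: D'_def mat_diag_def)
  moreover have "fls_X_intpow (as ! k) * fls_X_intpow (- (as ! k)) = (1 :: rat fls)" for k
    by (subst fls_X_intpow_times_fls_X_intpow) simp
  ultimately have DD': "?D * ?F D' = 1\<^sub>m r"
    by (simp only: mat_diag_diag mat_diag_one)
  have W: "?F V * ?F D' * ?F U \<in> carrier_mat r r"
    using FV FD' FU by simp
  have LE_inverse: "?L E * (?F V * ?F D' * ?F U) = 1\<^sub>m r"
  proof -
    have "?L E * (?F V * ?F D' * ?F U) = ?F U' * ?F U * (?L E * (?F V * ?F D' * ?F U))"
      using FU'U LE W by simp
    also have "\<dots> = ?F U' * (?F U * ?L E * ?F V * ?F D' * ?F U)"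
      using FU FU' FV FD' LE by (simp add: assoc_mult_mat[of _ r r _ r _ r])
    also have "\<dots> = 1\<^sub>m r"
      using smith DD' FU FU'U by simp
    finally show ?thesis .
  qed
  have LCE: "?L C * ?L E = 1\<^sub>m r"
    using L.mat_hom_mult[OF C E] CE L.mat_hom_one[of r] by simp
  have "?L C = ?L C * (?L E * (?F V * ?F D' * ?F U))"
    unfolding LE_inverse by (rule right_mult_one_mat[OF LC, symmetric])
  also have "\<dots> = ?L C * ?L E * (?F V * ?F D' * ?F U)"
    by (rule assoc_mult_mat[OF LC LE W, symmetric])
  also have "\<dots> = ?F V * ?F D' * ?F U"
    unfolding LCE by (rule left_mult_one_mat[OF W])
  also have "\<dots> = ?F (V * D' * U)"
    using F.mat_hom_mult[OF V(1) D'] F.mat_hom_mult[of "V * D'" r r U r] V D' U by simp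
  finally have "?L C $$ (i, j) = ?F (V * D' * U) $$ (i, j)"
    by simp
  then have "laurent_expansion 1 (C $$ (i, j)) = fps_to_fls ((V * D' * U) $$ (i, j))"
    using C U V D' ij by simp
  moreover have "fps_nth ((V * D' * U) $$ (i, j)) 0 = 0"
  proof -
    have "(V * D' * U) $$ (i, j) = (\<Sum>k<r. V $$ (i, k) * fps_X ^ nat (- (as ! k)) * U $$ (k, j))"
      using V U ij by (simp add: D'_def mat_diag_mult_right scalar_prod_def lessThan_atLeast0)
    then show ?thesis
      by (auto simp: fps_sum_nth intro!: sum.neutral dest!: as_neg)
  qed
  ultimately show thesis by (rule that)
qed


section \<open>Nonnegative power series of rational functions vanishing at one\<close>

lemma eval_fps_of_rat_poly:
  "eval_fps (Abs_fps (\<lambda>n. of_rat (coeff p n))) x = poly (map_poly of_rat p) (x :: real)"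
proof -
  have "Abs_fps (\<lambda>n. of_rat (coeff p n)) = fps_of_poly (map_poly of_rat p :: real poly)"
    by (intro fps_ext) (simp add: coeff_map_poly)
  then show ?thesis by simp
qed

lemma poly_map_of_rat_1:
  "poly (map_poly of_rat p) 1 = (of_rat (poly p 1) :: 'a::field_char_0)"
  by (simp add: poly_altdef degree_map_poly coeff_map_poly of_rat_sum)

text \<open>
  Write the rational function as \<open>p / q\<close> in lowest terms, so that \<open>p(1) = 0 \<noteq> q(1)\<close>. If the series
  \<open>h\<close> converged on \<open>[0, 1)\<close>, then \<open>p = h q\<close> there, and \<open>h \<ge> 1\<close> would give \<open>\<bar>q\<bar> \<le> \<bar>p\<bar>\<close>, which fails
  in the limit at \<open>1\<close>.
\<close>

lemma conv_radius_less_one_if_vanishing_at_one: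
  fixes H :: "int fps"
  assumes at_0: "laurent_expansion 0 R = int_fps_to_fls H"
    and at_1: "laurent_expansion 1 R = fps_to_fls G" "fps_nth G 0 = 0"
    and nonneg: "\<And>n. fps_nth H n \<ge> 0" and pos: "fps_nth H 0 > 0"
  shows "conv_radius (\<lambda>n. real_of_int (fps_nth H n)) < 1"
proof (rule ccontr)
  assume "\<not> ?thesis"
  then have radius: "conv_radius (\<lambda>n. real_of_int (fps_nth H n)) \<ge> 1" by simp
  obtain p q where pq: "quot_of_fract R = (p, q)" by (cases "quot_of_fract R")
  have q: "q \<noteq> 0"
    using snd_quot_of_fract_nonzero[of R] by (simp add: pq)
  have "coprime p q"
    using coprime_quot_of_fract[of R] by (simp add: pq)
  let ?P = "Abs_fps (\<lambda>n. of_rat (coeff p n)) :: real fps"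
  let ?Q = "Abs_fps (\<lambda>n. of_rat (coeff q n)) :: real fps"
  let ?p = "poly (map_poly of_rat p) :: real \<Rightarrow> real"
  let ?q = "poly (map_poly of_rat q) :: real \<Rightarrow> real"
  define h where "h = Abs_fps (\<lambda>n. real_of_int (fps_nth H n))"

  \<comment> \<open>Constant terms in the expansion at \<open>1\<close> are values at \<open>1\<close>; lowest terms exclude a common zero.\<close>
  have "fps_to_fls (fps_of_poly (p \<circ>\<^sub>p [:1, 1:])) =
      fps_to_fls (G * fps_of_poly (q \<circ>\<^sub>p [:1, 1:]))"
    using at_1(1) q by (simp add: laurent_expansion_def pq fls_times_fps_to_fls divide_eq_eq)
  then have "fps_of_poly (p \<circ>\<^sub>p [:1, 1:]) = G * fps_of_poly (q \<circ>\<^sub>p [:1, 1:])"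
    by (simp only: fps_to_fls_eq_iff)
  then have "coeff (p \<circ>\<^sub>p [:1, 1:]) 0 = 0"
    using at_1(2) by (metis fps_mult_nth_0 fps_of_poly_nth mult_zero_left)
  then have p1: "poly p 1 = 0"
    by (simp add: poly_0_coeff_0[symmetric] poly_pcompose)
  have q1: "poly q 1 \<noteq> 0"
  proof
    assume "poly q 1 = 0"
    with p1 have "[:-1, 1:] dvd p" "[:-1, 1:] dvd q"
      by (simp_all add: poly_eq_0_iff_dvd)
    with \<open>coprime p q\<close> have "is_unit [:-1, 1 :: rat:]"
      by (rule coprime_common_divisor)
    then show False by (simp add: is_unit_pCons_iff)
  qed

  \<comment> \<open>The identity \<open>p = H q\<close> over \<open>\<rat>\<close> is carried to real coefficients, where it can be evaluated.\<close>
  have "fps_to_fls (fps_of_poly p) =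
      fps_to_fls (Abs_fps (\<lambda>n. rat_of_int (fps_nth H n)) * fps_of_poly q)"
    using at_0 q
    by (simp add: laurent_expansion_def pq fls_times_fps_to_fls divide_eq_eq int_fps_to_fls_def
        pcompose_idR fps_of_poly_eq_iff[of _ 0, simplified])
  then have "fps_of_poly p = Abs_fps (\<lambda>n. rat_of_int (fps_nth H n)) * fps_of_poly q"
    by (simp only: fps_to_fls_eq_iff)
  then have coeff_p: "coeff p n = (\<Sum>k=0..n. rat_of_int (fps_nth H k) * coeff q (n - k))" for n
    by (metis (no_types, lifting) fps_mult_nth fps_nth_Abs_fps fps_of_poly_nth sum.cong)
  have P: "?P = h * ?Q"
    by (rule fps_ext) (simp add: coeff_p h_def fps_mult_nth of_rat_sum of_rat_mult)

  have le: "\<bar>?q x\<bar> \<le> \<bar>?p x\<bar>" if x: "0 < x" "x < 1" for x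
  proof -
    have "norm x < 1" using x by simp
    then have "ereal (norm x) < 1" by simp
    also note radius
    finally have conv_h: "ereal (norm x) < fps_conv_radius h"
      by (simp add: fps_conv_radius_def h_def)
    have "?Q = fps_of_poly (map_poly of_rat q)"
      by (intro fps_ext) (simp add: coeff_map_poly)
    then have "ereal (norm x) < fps_conv_radius ?Q" by simp
    then have eval: "?p x = eval_fps h x * ?q x"
      using conv_h P by (metis eval_fps_mult eval_fps_of_rat_poly)
    have "(\<Sum>n<1. fps_nth h n * x ^ n) \<le> eval_fps h x"
      unfolding eval_fps_def
      using summable_fps[OF conv_h] nonneg x by (intro sum_le_suminf) (auto simp: h_def)
    then have "1 \<le> eval_fps h x"
      using pos by (simp add: h_def)
    then have "1 * \<bar>?q x\<bar> \<le> \<bar>eval_fps h x\<bar> * \<bar>?q x\<bar>"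
      by (intro mult_right_mono) auto
    then show ?thesis by (simp add: eval abs_mult)
  qed
  have "((\<lambda>x. \<bar>?q x\<bar>) \<longlongrightarrow> \<bar>?q 1\<bar>) (at_left 1)" "((\<lambda>x. \<bar>?p x\<bar>) \<longlongrightarrow> \<bar>?p 1\<bar>) (at_left 1)"
    by (intro tendsto_intros)+
  moreover have "eventually (\<lambda>x. \<bar>?q x\<bar> \<le> \<bar>?p x\<bar>) (at_left 1)"
    using le by (auto simp: eventually_at_left_field intro: exI[of _ 0])
  ultimately have "\<bar>?q 1\<bar> \<le> \<bar>?p 1\<bar>"
    by (intro tendsto_le[of "at_left (1 :: real)"]) auto
  then show False
    using p1 q1 by (simp add: poly_map_of_rat_1)
qed


section \<open>The degree-zero corner\<close>

text \<open>
  The corner \<open>e\<^sub>i A\<^sub>0 e\<^sub>i\<close> contains \<open>e\<^sub>i \<noteq> 0\<close>. Since \<open>dim\<close> is \<open>0\<close> for spaces of infinite dimension, a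
  finite spanning set is needed as well; by orthogonality \<open>e\<^sub>i\<close> alone is one.
\<close>

lemma (in elementary_graded_algebra) dim_corner_zero_pos:
  assumes i: "i < r"
  shows "dim (corner_component i i 0) > 0"
proof -
  have idem: "e i * e i = e i" and nz: "e i \<noteq> 0"
    using primitive[OF i] by (auto simp: primitive_idempotent_def)
  have "e i * x * e i \<in> span {e i}" if "x \<in> span (e ` {..<r})" for x
    using that
  proof (induction rule: span_induct_alt)
    case base
    then show ?case by (simp add: span_zero)
  next
    case (step c y z)
    from step(1) obtain k where k: "k < r" "y = e k" by auto
    have "e i * y * e i \<in> span {e i}"
      using k i orthogonal[of i k] idem by (cases "k = i") (auto simp: span_zero span_base)
    then have "scale c (e i * y * e i) + e i * z * e i \<in> span {e i}"
      using step(2) by (intro span_add span_scale)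
    then show ?case
      by (simp add: distrib_left distrib_right scale_mult_left scale_mult_right)
  qed
  then have sub: "corner_component i i 0 \<subseteq> span {e i}"
    by (auto simp: corner_component_def span_idempotents)
  have "e i \<in> A 0"
    using i span_idempotents by (metis imageI lessThan_iff span_base)
  moreover have "e i = e i * e i * e i"
    by (simp add: idem)
  ultimately have "e i \<in> corner_component i i 0"
    unfolding corner_component_def by blast
  then have "span (corner_component i i 0) = span {e i}"
    using sub by (intro equalityI span_minimal subspace_span) (auto intro: span_base)
  then have "dim (corner_component i i 0) = card {e i}"
    using nz by (intro dim_eq_card) auto
  then show ?thesis by simp
qed


section \<open>Exponential growth of the corners\<close>

theorem proposition5p6:
  fixes scale :: "'k::field \<Rightarrow> 'a::ring_1 \<Rightarrow> 'a"
    and A :: "nat \<Rightarrow> 'a set" and e :: "nat \<Rightarrow> 'a" and r :: nat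
    and C E :: "rat poly fract mat" and as :: "int list"
  assumes "elementary_graded_algebra scale A e r"
    and "\<forall>j<r. graded_FP_infinity A (elementary_graded_algebra.vertex_simple scale A e j)"
    and "rational_form r (elementary_graded_algebra.matrix_hilbert_series scale A e r) C"
    and "E \<in> carrier_mat r r" and "inverts_mat C E" and "inverts_mat E C"
    and "signed_euler_smith_profile r E as"
    and "last as < 0"
  shows "\<forall>i<r. conv_radius (\<lambda>n. real_of_int
           (fps_nth (elementary_graded_algebra.hilbert_series scale A e i i) n)) < 1"
proof (intro allI impI)
  fix i assume i: "i < r"
  interpret elementary_graded_algebra scale A e r by (rule assms(1))
  have C: "C \<in> carrier_mat r r"
    and expand: "map_mat (laurent_expansion 0) C = map_mat int_fps_to_fls matrix_hilbert_series"
    using assms(3) by (auto simp: rational_form_def)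
  have "C * E = 1\<^sub>m r"
    using assms(5) C by (simp add: inverts_mat_def)
  then obtain G where G: "laurent_expansion 1 (C $$ (i, i)) = fps_to_fls G" "fps_nth G 0 = 0"
    using inverse_entry_vanishes_at_one[OF C assms(4) _ assms(7,8) i i] by blast
  have "laurent_expansion 0 (C $$ (i, i)) = int_fps_to_fls (hilbert_series i i)"
    using arg_cong[OF expand, of "\<lambda>M. M $$ (i, i)"] C i
    by (simp add: matrix_hilbert_series_def)
  then show "conv_radius (\<lambda>n. real_of_int (fps_nth (hilbert_series i i) n)) < 1"
    by (rule conv_radius_less_one_if_vanishing_at_one[OF _ G])
      (use dim_corner_zero_pos[OF i] in \<open>auto simp: hilbert_series_def\<close>)
qed

end
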